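(* For any $n\geq1$ and $w\in\{+,-\}^n$, we have \begin{align*} Q^+_{w+}&=\Phi_{2,2,1}(Q^-_w)+\Phi_{3,1,2}(Q^+_w),\\ Q^-_{w+}&=\Phi_{1,1,3}(Q^+_w),\\ Q^+_{w-}&=\Phi_{1,1,2}(Q^-_w),\\ Q^-_{w-}&=\Phi_{3,3,1}(Q^+_w)+\Phi_{2,1,3}(Q^-_w). \end{align*}
   Context: A total cyclic order on a finite set $X$ is a set $Z$ of triples of distinct elements of $X$ such that: $(x,y,z)\in Z\Rightarrow (y,z,x)\in Z$; $(x,y,z)\in Z\Rightarrow (z,y,x)\notin Z$; $(x,y,z)\in Z$ and $(x,z,u)\in Z\Rightarrow (x,y,u)\in Z$; and for any three distinct $x,y,z$, either $(x,y,z)\in Z$ or $(z,y,x)\in Z$. For $w=\epsilon_1\cdots\epsilon_{m-2}\in\{+,-\}^{m-2}$ ($m\geq3$), $\mathcal{P}_w$ is the set of total cyclic orders $Z$ on $[m]$ such that for every $1\leq i\leq m-2$, $(i,i+1,i+2)\in Z$ if $\epsilon_i=+$ and $(i+2,i+1,i)\in Z$ if $\epsilon_i=-$. $\mathcal{Q}^+_w$ (resp. $\mathcal{Q}^-_w$) is the set of $Z\in\mathcal{P}_w$ with $(m-1,m,1)\in Z$ (resp. $(1,m,m-1)\in Z$). Let $c_Z(a,b)=\#\{x:(a,x,b)\in Z\}$ and $\tilde c_Z(y_1,\dots,y_p)=(c_Z(y_1,y_2),\dots,c_Z(y_{p-1},y_p),c_Z(y_p,y_1))$. For $w\in\{+,-\}^{m-2}$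 and $i+j+k=m-3$, $f^+_{w,i,j,k}=\#\{Z\in\mathcal{Q}^+_w:\tilde c_Z(m-1,m,1)=(i,j,k)\}$ and $f^-_{w,i,j,k}=\#\{Z\in\mathcal{Q}^-_w:\tilde c_Z(m,m-1,1)=(i,j,k)\}$. For $w\in\{+,-\}^n$ and $\eta\in\{+,-\}$, $Q^\eta_w(X_1,X_2,X_3)=\sum_{i+j+k=n-1} f^\eta_{w,i,j,k}X_1^iX_2^jX_3^k$. The words $w+$, $w-$ are $w$ with $+$, resp. $-$, appended. For $m'\geq2$ and $1\leq a,b,c\leq m'$ with $b\neq c$, $\Phi_{a,b,c}$ is the linear endomorphism of $\mathbb{Z}[X_1,\dots,X_{m'}]$ defined on monomials by $\Phi_{a,b,c}\left(\prod_{\ell} X_\ell^{i_\ell}\right)=\left(\prod_{\ell\notin\{b,c\}}X_\ell^{i_\ell}\right)X_a^{i_b+1}\sum_{k=0}^{i_c}X_b^{i_c-k}X_c^{k}$ (here with $m'=3$). *)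

theory Defs
  imports "HOL-Library.Poly_Mapping"
begin

section \<open>Total cyclic orders\<close>

definition total_cyclic_order :: "'a set \<Rightarrow> ('a \<times> 'a \<times> 'a) set \<Rightarrow> bool" where
  "total_cyclic_order X Z \<longleftrightarrow>
     (\<forall>x y z. (x, y, z) \<in> Z \<longrightarrow>
        x \<in> X \<and> y \<in> X \<and> z \<in> X \<and> x \<noteq> y \<and> y \<noteq> z \<and> x \<noteq> z) \<and>
     (\<forall>x y z. (x, y, z) \<in> Z \<longrightarrow> (y, z, x) \<in> Z) \<and>
     (\<forall>x y z. (x, y, z) \<in> Z \<longrightarrow> (z, y, x) \<notin> Z) \<and>
     (\<forall>x y z u. (x, y, z) \<in> Z \<and> (x, z, u) \<in> Z \<longrightarrow> (x, y, u) \<in> Z) \<and>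
     (\<forall>x\<in>X. \<forall>y\<in>X. \<forall>z\<in>X. x \<noteq> y \<and> y \<noteq> z \<and> x \<noteq> z \<longrightarrow>
        (x, y, z) \<in> Z \<or> (z, y, x) \<in> Z)"

datatype sign = Plus | Minus

text \<open>
  A word of length \<open>m - 2\<close> describes total cyclic orders on \<open>{1..m}\<close>. List positions
  start at 0, so the letter with index \<open>i\<close> is \<open>w ! (i - 1)\<close>.
\<close>

definition P_set :: "sign list \<Rightarrow> (nat \<times> nat \<times> nat) set set" where
  "P_set w = {Z. total_cyclic_order {1..length w + 2} Z \<and>
     (\<forall>i\<in>{1..length w}.
        (w ! (i - 1) = Plus \<longrightarrow> (i, i + 1, i + 2) \<in> Z) \<and>
        (w ! (i - 1) = Minus \<longrightarrow> (i + 2, i + 1, i) \<in> Z))}"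

fun Q_set :: "sign \<Rightarrow> sign list \<Rightarrow> (nat \<times> nat \<times> nat) set set" where
  "Q_set Plus w = (let m = length w + 2 in {Z \<in> P_set w. (m - 1, m, 1) \<in> Z})"
| "Q_set Minus w = (let m = length w + 2 in {Z \<in> P_set w. (1, m, m - 1) \<in> Z})"

definition c_between :: "('a \<times> 'a \<times> 'a) set \<Rightarrow> 'a \<Rightarrow> 'a \<Rightarrow> nat" where
  "c_between Z a b = card {x. (a, x, b) \<in> Z}"

definition c_tilde :: "('a \<times> 'a \<times> 'a) set \<Rightarrow> 'a list \<Rightarrow> nat list" where
  "c_tilde Z ys = map2 (c_between Z) ys (rotate1 ys)"

fun f_count :: "sign \<Rightarrow> sign list \<Rightarrow> nat \<Rightarrow> nat \<Rightarrow> nat \<Rightarrow> nat" where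
  "f_count Plus w i j k = (let m = length w + 2 in
     card {Z \<in> Q_set Plus w. c_tilde Z [m - 1, m, 1] = [i, j, k]})"
| "f_count Minus w i j k = (let m = length w + 2 in
     card {Z \<in> Q_set Minus w. c_tilde Z [m, m - 1, 1] = [i, j, k]})"

section \<open>Integer polynomials\<close>

text \<open>
  Integer polynomials in the variables \<open>Var 0, Var 1, \<dots>\<close>: a monomial is its finitely supported
  exponent vector, and a polynomial maps finitely many monomials to their coefficients.
  The ring of polynomials in \<open>Var 1, \<dots>, Var m\<close> is the subring of those whose exponent vectors
  are supported in \<open>{1..m}\<close>.
\<close>

type_synonym int_mpoly = "(nat \<Rightarrow>\<^sub>0 nat) \<Rightarrow>\<^sub>0 int"

definition Var :: "nat \<Rightarrow> int_mpoly" where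
  "Var l = frag_of (Poly_Mapping.single l 1)"

lemma finite_sum_triples: "finite {(i, j, k). i + j + k = (n :: nat)}"
  by (rule finite_subset[of _ "{..n} \<times> {..n} \<times> {..n}"]) auto

definition Q_poly :: "sign \<Rightarrow> sign list \<Rightarrow> int_mpoly" where
  "Q_poly \<eta> w = (\<Sum>(i, j, k)\<in>{(i, j, k). i + j + k = length w - 1}.
     of_nat (f_count \<eta> w i j k) * Var 1 ^ i * Var 2 ^ j * Var 3 ^ k)"

definition Phi_monom :: "nat \<Rightarrow> nat \<Rightarrow> nat \<Rightarrow> (nat \<Rightarrow>\<^sub>0 nat) \<Rightarrow> int_mpoly" where
  "Phi_monom a b c e =
     (\<Prod>l\<in>Poly_Mapping.keys e - {b, c}. Var l ^ Poly_Mapping.lookup e l) *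
     Var a ^ (Poly_Mapping.lookup e b + 1) *
     (\<Sum>k=0..Poly_Mapping.lookup e c. Var b ^ (Poly_Mapping.lookup e c - k) * Var c ^ k)"

text \<open>
  \<open>frag_extend\<close> is the extension by linearity from monomials to polynomials. The definition
  does not depend on the number \<open>m\<close> of variables; \<open>Phi_prod\<close> and \<open>Phi_closed\<close>
  below show that it acts on the polynomials in \<open>Var 1, \<dots>, Var m\<close> as intended.
\<close>

definition Phi :: "nat \<Rightarrow> nat \<Rightarrow> nat \<Rightarrow> int_mpoly \<Rightarrow> int_mpoly" where
  "Phi a b c = frag_extend (Phi_monom a b c)"

lemma Var_power: "Var l ^ n = frag_of (Poly_Mapping.single l n)"
  by (induction n) (simp_all add: Var_def mult_single flip: single_add)

lemma prod_Var_power: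
  "finite A \<Longrightarrow> (\<Prod>l\<in>A. Var l ^ i l) = frag_of (\<Sum>l\<in>A. Poly_Mapping.single l (i l))"
  by (induction A rule: finite_induct) (simp_all add: Var_power mult_single)

lemma Phi_prod:
  assumes "b \<in> {1..m}" and "c \<in> {1..m}"
  shows "Phi a b c (\<Prod>l\<in>{1..m}. Var l ^ i l) =
    (\<Prod>l\<in>{1..m} - {b, c}. Var l ^ i l) * Var a ^ (i b + 1) * (\<Sum>k=0..i c. Var b ^ (i c - k) * Var c ^ k)"
proof -
  define e where "e = (\<Sum>l\<in>{1..m}. Poly_Mapping.single l (i l))"
  have lookup_e: "Poly_Mapping.lookup e l = (if l \<in> {1..m} then i l else 0)" for l
    by (simp add: e_def lookup_sum lookup_single when_def)
  have "(\<Prod>l\<in>Poly_Mapping.keys e - {b, c}. Var l ^ Poly_Mapping.lookup e l) =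
      (\<Prod>l\<in>{1..m} - {b, c}. Var l ^ i l)"
    by (rule prod.mono_neutral_cong_left) (auto simp: in_keys_iff lookup_e intro!: gr0I split: if_splits)
  then have "Phi_monom a b c e =
    (\<Prod>l\<in>{1..m} - {b, c}. Var l ^ i l) * Var a ^ (i b + 1) * (\<Sum>k=0..i c. Var b ^ (i c - k) * Var c ^ k)"
    using assms by (simp add: Phi_monom_def lookup_e)
  moreover have "(\<Prod>l\<in>{1..m}. Var l ^ i l) = frag_of e"
    unfolding e_def by (rule prod_Var_power) simp
  ultimately show ?thesis
    by (simp only: Phi_def frag_extend_of)
qed

definition polys_in :: "nat set \<Rightarrow> int_mpoly set" where
  "polys_in V = {p. \<forall>e\<in>Poly_Mapping.keys p. Poly_Mapping.keys e \<subseteq> V}"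

lemma polys_in_0: "0 \<in> polys_in V"
  by (simp add: polys_in_def)

lemma polys_in_add: "p \<in> polys_in V \<Longrightarrow> q \<in> polys_in V \<Longrightarrow> p + q \<in> polys_in V"
  using keys_add[of p q] by (auto simp: polys_in_def)

lemma polys_in_mult: "p \<in> polys_in V \<Longrightarrow> q \<in> polys_in V \<Longrightarrow> p * q \<in> polys_in V"
  unfolding polys_in_def using keys_mult[of p q] keys_add by (fastforce dest!: subsetD)

lemma polys_in_Var_power: "l \<in> V \<Longrightarrow> Var l ^ n \<in> polys_in V"
  by (auto simp: polys_in_def Var_power split: if_splits)

lemma polys_in_sum: "(\<And>s. s \<in> S \<Longrightarrow> g s \<in> polys_in V) \<Longrightarrow> sum g S \<in> polys_in V"
  by (induction S rule: infinite_finite_induct) (simp_all add: polys_in_0 polys_in_add)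

lemma polys_in_prod: "(\<And>s. s \<in> S \<Longrightarrow> g s \<in> polys_in V) \<Longrightarrow> prod g S \<in> polys_in V"
  by (induction S rule: infinite_finite_induct)
    (simp_all add: polys_in_mult, simp_all add: polys_in_def)

lemma polys_in_cmul: "p \<in> polys_in V \<Longrightarrow> frag_cmul n p \<in> polys_in V"
  using keys_cmul[of n p] by (auto simp: polys_in_def)

lemma Phi_closed:
  assumes "a \<in> {1..m}" "b \<in> {1..m}" "c \<in> {1..m}" and "p \<in> polys_in {1..m}"
  shows "Phi a b c p \<in> polys_in {1..m}"
proof -
  have "Phi_monom a b c e \<in> polys_in {1..m}" if "e \<in> Poly_Mapping.keys p" for e
  proof -
    have "Poly_Mapping.keys e \<subseteq> {1..m}"
      using that assms(4) by (simp add: polys_in_def)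
    then show ?thesis
      unfolding Phi_monom_def using assms(1-3)
      by (intro polys_in_mult polys_in_sum polys_in_prod polys_in_Var_power) auto
  qed
  then show ?thesis
    unfolding Phi_def frag_extend_def by (intro polys_in_sum polys_in_cmul)
qed

end

theory Submission
  imports Defs
begin

text \<open>
  Restricting a total cyclic order on \<open>{1..m + 1}\<close> to \<open>{1..m}\<close> leaves one on \<open>{1..m}\<close>, and the
  orders lying above a given \<open>Z\<close> with \<open>m + 1\<close> placed in the arc from \<open>a\<close> to \<open>b\<close> are parametrised
  by the number \<open>s \<le> c_between Z a b\<close> of elements between \<open>a\<close> and \<open>m + 1\<close>. The three elements
  \<open>m - 1\<close>, \<open>m\<close>, \<open>1\<close> cut the cycle into three arcs; the appended letter and the sign of the new
  order decide which single arc, if any, may receive \<open>m + 1\<close>. The new arc lengths are then linear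
  in \<open>s\<close> and the old ones, and the sum over \<open>s\<close> is the sum that defines \<open>Phi\<close>.
\<close>

section \<open>Insertion into a cyclic order\<close>

text \<open>The linear order of the ranks closed up into a circle: the three disjuncts are the
  rotations of \<open>r x < r y < r z\<close>.\<close>

definition rank_cyclic :: "'a set \<Rightarrow> ('a \<Rightarrow> nat) \<Rightarrow> ('a \<times> 'a \<times> 'a) set" where
  "rank_cyclic X r = {(x, y, z). x \<in> X \<and> y \<in> X \<and> z \<in> X \<and>
     (r x < r y \<and> r y < r z \<or> r y < r z \<and> r z < r x \<or> r z < r x \<and> r x < r y)}"

lemma mem_rank_cyclic:
  "(x, y, z) \<in> rank_cyclic X r \<longleftrightarrow> x \<in> X \<and> y \<in> X \<and> z \<in> X \<and>
     (r x < r y \<and> r y < r z \<or> r y < r z \<and> r z < r x \<or> r z < r x \<and> r x < r y)"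
  by (simp add: rank_cyclic_def)

lemma total_cyclic_order_rank_cyclic:
  assumes "inj_on r X"
  shows "total_cyclic_order X (rank_cyclic X r)"
proof -
  have "r x < r y \<or> r y < r x" if "x \<in> X" "y \<in> X" "x \<noteq> y" for x y
    using assms that by (metis inj_onD linorder_neqE_nat)
  then show ?thesis
    unfolding total_cyclic_order_def mem_rank_cyclic
    apply (intro conjI allI impI ballI)
    subgoal by blast
    subgoal by blast
    subgoal by blast
    subgoal by force
    subgoal by force
    subgoal by force
    subgoal by blast
    subgoal by blast
    subgoal by blast
    subgoal by linarith
    subgoal by linarith
    subgoal by blast
    subgoal by blast
    subgoal by blast
    subgoal by linarith
    subgoal by metis
    done
qed

section \<open>Elementary properties of cyclic orders\<close>

locale cyclic_order =
  fixes X :: "'a set" and Z :: "('a \<times> 'a \<times> 'a) set"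
  assumes total_cyclic_order: "total_cyclic_order X Z"
begin

lemma in_carrier: "(x, y, z) \<in> Z \<Longrightarrow> x \<in> X \<and> y \<in> X \<and> z \<in> X"
  using total_cyclic_order[unfolded total_cyclic_order_def, THEN conjunct1] by blast

lemma distinct: "(x, y, z) \<in> Z \<Longrightarrow> x \<noteq> y \<and> y \<noteq> z \<and> x \<noteq> z"
  using total_cyclic_order[unfolded total_cyclic_order_def, THEN conjunct1] by blast

lemma rotate: "(x, y, z) \<in> Z \<Longrightarrow> (y, z, x) \<in> Z"
  using total_cyclic_order[unfolded total_cyclic_order_def, THEN conjunct2, THEN conjunct1] by blast

lemma rotate': "(x, y, z) \<in> Z \<Longrightarrow> (z, x, y) \<in> Z"
  by (rule rotate[OF rotate])

lemma asym: "(x, y, z) \<in> Z \<Longrightarrow> (z, y, x) \<notin> Z"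
  using total_cyclic_order[unfolded total_cyclic_order_def, THEN conjunct2, THEN conjunct2, THEN conjunct1] by blast

lemma trans: "(x, y, z) \<in> Z \<Longrightarrow> (x, z, u) \<in> Z \<Longrightarrow> (x, y, u) \<in> Z"
  using total_cyclic_order[unfolded total_cyclic_order_def, THEN conjunct2, THEN conjunct2, THEN conjunct2, THEN conjunct1] by blast

lemma total:
  "x \<in> X \<Longrightarrow> y \<in> X \<Longrightarrow> z \<in> X \<Longrightarrow> x \<noteq> y \<Longrightarrow> y \<noteq> z \<Longrightarrow> x \<noteq> z \<Longrightarrow> (x, y, z) \<in> Z \<or> (z, y, x) \<in> Z"
  using total_cyclic_order[unfolded total_cyclic_order_def, THEN conjunct2, THEN conjunct2, THEN conjunct2, THEN conjunct2] by blast

text \<open>The point \<open>x\<close> cuts the arc from \<open>a\<close> to \<open>b\<close> in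
  two. If \<open>u\<close> is on the arc, differs from \<open>x\<close> and is not before it,
  totality gives \<open>(x, u, a)\<close>, and transitivity based at \<open>u\<close> replaces
  \<open>a\<close> by \<open>b\<close>.\<close>

lemma between_iff:
  assumes "(a, x, b) \<in> Z"
  shows "(a, u, b) \<in> Z \<longleftrightarrow> u = x \<or> (a, u, x) \<in> Z \<or> (x, u, b) \<in> Z"
proof
  assume u: "(a, u, b) \<in> Z"
  have "(x, u, b) \<in> Z" if "u \<noteq> x" "(a, u, x) \<notin> Z"
  proof -
    have "(x, u, a) \<in> Z"
      using that total[of a u x] in_carrier[OF u] in_carrier[OF assms] distinct[OF u] distinct[OF assms] by blast
    then have "(u, b, x) \<in> Z"
      using trans[OF rotate[OF u] rotate] by blast
    then show ?thesis
      by (rule rotate')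
  qed
  then show "u = x \<or> (a, u, x) \<in> Z \<or> (x, u, b) \<in> Z"
    by blast
next
  assume "u = x \<or> (a, u, x) \<in> Z \<or> (x, u, b) \<in> Z"
  then consider "u = x" | "(a, u, x) \<in> Z" | "(x, u, b) \<in> Z"
    by blast
  then show "(a, u, b) \<in> Z"
  proof cases
    case 3
    then have "(b, a, u) \<in> Z"
      by (rule trans[OF rotate'[OF assms] rotate'])
    then show ?thesis
      by (rule rotate)
  next
    case 2
    then show ?thesis
      using assms by (rule trans)
  qed (use assms in simp)
qed

lemma between_disjoint:
  assumes "(a, x, b) \<in> Z" "(a, u, x) \<in> Z"
  shows "(x, u, b) \<notin> Z"
  using trans[OF _ rotate[OF assms(1)], of u] asym[OF assms(2)] by blast

lemma total_cyclic_order_restrict: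
  assumes "Y \<subseteq> X"
  shows "total_cyclic_order Y (Z \<inter> Y \<times> Y \<times> Y)"
  unfolding total_cyclic_order_def
  apply (intro conjI allI impI ballI)
  subgoal by blast
  subgoal by blast
  subgoal by blast
  subgoal using distinct by blast
  subgoal using distinct by blast
  subgoal using distinct by blast
  subgoal using rotate by blast
  subgoal using asym by blast
  subgoal using trans by blast
  subgoal for x y z using total[of x y z] assms by blast
  done

text \<open>Cutting the circle at \<open>a\<close> gives a linear order that determines the cyclic
  one, so an order is identified by its triples that start at \<open>a\<close>.\<close>

lemma eq_rank_cyclic:
  assumes a: "a \<in> X"
    and least: "\<And>x. x \<in> X \<Longrightarrow> x \<noteq> a \<Longrightarrow> r a < r x"
    and less: "\<And>x y. x \<in> X \<Longrightarrow> y \<in> X \<Longrightarrow> x \<noteq> a \<Longrightarrow> y \<noteq> a \<Longrightarrow> (a, x, y) \<in> Z \<longleftrightarrow> r x < r y"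
  shows "Z = rank_cyclic X r"
proof -
  have inj: "x = y" if "x \<in> X" "y \<in> X" "r x = r y" for x y
    using that least less total[of a x y] by (metis a less_irrefl rotate)
  have sub: "(x, y, z) \<in> Z" if "(x, y, z) \<in> rank_cyclic X r" for x y z
  proof -
    have step: "(x, y, z) \<in> Z" if "x \<in> X" "y \<in> X" "z \<in> X" "r x < r y" "r y < r z" for x y z
    proof (cases "x = a")
      case True
      then show ?thesis using that less by (metis less_irrefl less_trans)
    next
      case False
      then have "y \<noteq> a" "z \<noteq> a"
        using that least by (metis less_asym)+
      then have "(a, x, y) \<in> Z" "(a, y, z) \<in> Z"
        using that False less by auto
      \<comment> \<open>Change of base point: \<open>(y, z, a)\<close> and \<open>(y, a, x)\<close>
        give \<open>(y, z, x)\<close>.\<close>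
      then show ?thesis
        using trans[of y z a x] rotate by blast
    qed
    show ?thesis
      using that step rotate unfolding mem_rank_cyclic by blast
  qed
  \<comment> \<open>The converse inclusion follows from totality: a triple of \<open>Z\<close>
    missing from the ranked order would have its reversal there, hence in \<open>Z\<close>.\<close>
  have "(x, y, z) \<in> rank_cyclic X r" if Z: "(x, y, z) \<in> Z" for x y z
  proof (rule ccontr)
    assume n: "(x, y, z) \<notin> rank_cyclic X r"
    have "inj_on r X"
      using inj by (auto intro: inj_onI)
    then interpret R: cyclic_order X "rank_cyclic X r"
      by unfold_locales (rule total_cyclic_order_rank_cyclic)
    have "(z, y, x) \<in> rank_cyclic X r"
      using n R.total in_carrier[OF Z] distinct[OF Z] by blast
    then show False
      using sub asym[OF Z] by blast
  qed
  then show ?thesis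
    using sub by auto
qed

end

section \<open>Arc lengths in a finite cyclic order\<close>

locale finite_cyclic_order = cyclic_order +
  assumes finite_carrier: "finite X"
begin

lemma finite_between: "finite {x. (a, x, b) \<in> Z}"
  by (rule finite_subset[OF _ finite_carrier]) (use in_carrier in blast)

text \<open>The count is the position on the circle cut at \<open>a\<close>: initial arcs are
  nested, and \<open>x\<close> lies only in the larger one. The point \<open>a\<close> is excluded
  since its own count is 0, like that of its immediate successor.\<close>

lemma c_between_less_iff:
  assumes "a \<in> X" "x \<in> X" "y \<in> X" "x \<noteq> a" "y \<noteq> a"
  shows "(a, x, y) \<in> Z \<longleftrightarrow> c_between Z a x < c_between Z a y"
proof -
  have less: "c_between Z a x < c_between Z a y" if "(a, x, y) \<in> Z" for x y
  proof -
    have "{u. (a, u, x) \<in> Z} \<subseteq> {u. (a, u, y) \<in> Z}"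
      using that trans by blast
    moreover have "x \<in> {u. (a, u, y) \<in> Z} - {u. (a, u, x) \<in> Z}"
      using that distinct by blast
    ultimately show ?thesis
      unfolding c_between_def by (intro psubset_card_mono finite_between) blast
  qed
  show ?thesis
  proof
    assume *: "c_between Z a x < c_between Z a y"
    then have "(a, x, y) \<in> Z \<or> (y, x, a) \<in> Z"
      using total[of a x y] assms by blast
    then show "(a, x, y) \<in> Z"
      using * less[of y x] rotate'[of y x a] by fastforce
  qed (rule less)
qed

lemma c_between_add:
  assumes "(a, x, b) \<in> Z"
  shows "c_between Z a b = Suc (c_between Z a x + c_between Z x b)"
proof -
  have "{u. (a, u, b) \<in> Z} = insert x ({u. (a, u, x) \<in> Z} \<union> {u. (x, u, b) \<in> Z})"
    using between_iff[OF assms] by blast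
  moreover have "{u. (a, u, x) \<in> Z} \<inter> {u. (x, u, b) \<in> Z} = {}"
    using between_disjoint[OF assms] by blast
  moreover have "x \<notin> {u. (a, u, x) \<in> Z} \<union> {u. (x, u, b) \<in> Z}"
    using distinct by blast
  ultimately show ?thesis
    unfolding c_between_def by (simp add: card_Un_disjoint finite_between)
qed

text \<open>The three open arcs and their three end points exhaust \<open>X\<close>. This fixes the
  total degree of the monomials in \<open>Q_poly\<close>.\<close>

lemma sum_c_between:
  assumes "(a, b, c) \<in> Z"
  shows "c_between Z a b + c_between Z b c + c_between Z c a + 3 = card X"
proof -
  have "u = a \<or> u = c \<or> (a, u, c) \<in> Z \<or> (c, u, a) \<in> Z" if "u \<in> X" for u
    using that total[of a u c] in_carrier[OF assms] distinct[OF assms] by blast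
  then have "X = insert a (insert c ({u. (a, u, c) \<in> Z} \<union> {u. (c, u, a) \<in> Z}))"
    using in_carrier[OF assms] in_carrier by blast
  moreover have "card ({u. (a, u, c) \<in> Z} \<union> {u. (c, u, a) \<in> Z}) = c_between Z a c + c_between Z c a"
    unfolding c_between_def by (intro card_Un_disjoint finite_between) (use asym in blast)
  moreover have "c \<notin> {u. (a, u, c) \<in> Z} \<union> {u. (c, u, a) \<in> Z}"
    using distinct by blast
  moreover have "a \<notin> insert c ({u. (a, u, c) \<in> Z} \<union> {u. (c, u, a) \<in> Z})"
    using distinct[OF assms] distinct by blast
  ultimately have "card X = Suc (Suc (c_between Z a c + c_between Z c a))"
    by (simp add: finite_between)
  then show ?thesis
    using c_between_add[OF assms] by simp
qed

lemma c_between_inj: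
  assumes "a \<in> X" "x \<in> X" "y \<in> X" "x \<noteq> a" "y \<noteq> a" "c_between Z a x = c_between Z a y"
  shows "x = y"
proof (rule ccontr)
  assume "x \<noteq> y"
  then have "(a, x, y) \<in> Z \<or> (a, y, x) \<in> Z"
    using total[of a x y] rotate'[of y x a] assms by blast
  then show False
    using assms c_between_less_iff[of a] by auto
qed

text \<open>Positions are distinct and below \<open>card X - 1\<close>, so by cardinality every
  value occurs.\<close>

lemma bij_betw_c_between:
  assumes "a \<in> X"
  shows "bij_betw (c_between Z a) (X - {a}) {..<card X - 1}"
proof -
  have inj: "inj_on (c_between Z a) (X - {a})"
    by (rule inj_onI, rule c_between_inj[OF assms]) auto
  have "c_between Z a x < card X - 1" if "x \<in> X - {a}" for x
  proof -
    have "{u. (a, u, x) \<in> Z} \<subset> X - {a}"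
      using that in_carrier[of a _ x] distinct[of a _ x] by blast
    then show ?thesis
      unfolding c_between_def
      using assms finite_carrier by (metis card_Diff_singleton finite_Diff psubset_card_mono)
  qed
  then have "c_between Z a ` (X - {a}) \<subseteq> {..<card X - 1}"
    by blast
  moreover have "card (c_between Z a ` (X - {a})) = card {..<card X - 1}"
    using assms finite_carrier inj by (simp add: card_image)
  ultimately have "c_between Z a ` (X - {a}) = {..<card X - 1}"
    by (intro card_subset_eq) auto
  with inj show ?thesis
    by (simp add: bij_betw_def)
qed

end

section \<open>Extending an order by one point\<close>

definition extensions :: "'a set \<Rightarrow> ('a \<times> 'a \<times> 'a) set \<Rightarrow> 'a \<Rightarrow> ('a \<times> 'a \<times> 'a) set set" where
  "extensions X Z v = {Z'. total_cyclic_order (insert v X) Z' \<and> Z' \<inter> X \<times> X \<times> X = Z}"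

text \<open>Doubling the ranks of the old elements leaves an odd rank free for the new element \<open>v\<close>.\<close>

definition insert_rank :: "('a \<times> 'a \<times> 'a) set \<Rightarrow> 'a \<Rightarrow> 'a \<Rightarrow> nat \<Rightarrow> 'a \<Rightarrow> nat" where
  "insert_rank Z a v s x =
     (if x = v then 2 * s + 1 else if x = a then 0 else 2 * c_between Z a x + 2)"

context finite_cyclic_order
begin

lemma mem_extension_iff:
  assumes "Z' \<in> extensions X Z v" "x \<in> X" "y \<in> X" "z \<in> X"
  shows "(x, y, z) \<in> Z' \<longleftrightarrow> (x, y, z) \<in> Z"
  using assms unfolding extensions_def by blast

lemma finite_cyclic_order_extension:
  assumes "Z' \<in> extensions X Z v"
  shows "finite_cyclic_order (insert v X) Z'"
  using assms finite_carrier unfolding extensions_def by unfold_locales auto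

lemma c_between_extension:
  assumes "Z' \<in> extensions X Z v" "v \<notin> X" "x \<in> X" "y \<in> X"
  shows "c_between Z' x y = c_between Z x y + of_bool ((x, v, y) \<in> Z')"
proof -
  interpret E: finite_cyclic_order "insert v X" Z'
    using assms(1) by (rule finite_cyclic_order_extension)
  have v: "v \<notin> {u. (x, u, y) \<in> Z}"
    using assms(2) in_carrier by blast
  have "(x, u, y) \<in> Z' \<longleftrightarrow> (x, u, y) \<in> Z \<or> u = v \<and> (x, v, y) \<in> Z'" for u
    using assms(2) mem_extension_iff[OF assms(1,3) _ assms(4), of u] E.in_carrier[of x u y]
      in_carrier[of x u y] by blast
  then have "{u. (x, u, y) \<in> Z'} = {u. (x, u, y) \<in> Z} \<union> (if (x, v, y) \<in> Z' then {v} else {})"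
    by (cases "(x, v, y) \<in> Z'") (simp_all only: if_True if_False, blast+)
  then show ?thesis
    using v finite_between unfolding c_between_def by simp
qed

text \<open>Uniqueness: the position of \<open>v\<close> after \<open>a\<close> recovers the whole
  extension, since an old \<open>x\<close> precedes \<open>v\<close> exactly when its own old
  position is smaller than that of \<open>v\<close>.\<close>

lemma extension_eq_rank_cyclic:
  assumes "Z' \<in> extensions X Z v" "v \<notin> X" "a \<in> X"
  shows "Z' = rank_cyclic (insert v X) (insert_rank Z a v (c_between Z' a v))"
proof -
  interpret E: finite_cyclic_order "insert v X" Z'
    using assms(1) by (rule finite_cyclic_order_extension)
  have old_v: "(a, x, v) \<in> Z' \<longleftrightarrow> c_between Z a x < c_between Z' a v" if "x \<in> X" "x \<noteq> a" for x
  proof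
    assume *: "(a, x, v) \<in> Z'"
    then have "(a, v, x) \<notin> Z'"
      using E.asym[of a x v] E.rotate[of a v x] by blast
    then have "c_between Z' a x = c_between Z a x"
      using that assms by (simp add: c_between_extension)
    then show "c_between Z a x < c_between Z' a v"
      using * E.c_between_less_iff[of a x v] that assms by auto
  next
    assume *: "c_between Z a x < c_between Z' a v"
    show "(a, x, v) \<in> Z'"
    proof (rule ccontr)
      assume "(a, x, v) \<notin> Z'"
      then have "(a, v, x) \<in> Z'"
        using E.total[of a x v] E.rotate'[of v x a] that assms by blast
      \<comment> \<open>Here \<open>v\<close> itself is counted between \<open>a\<close> and
        \<open>x\<close>, hence the successor.\<close>
      then have "c_between Z' a v < c_between Z' a x" "c_between Z' a x = Suc (c_between Z a x)"
        using E.c_between_less_iff[of a v x] that assms by (auto simp: c_between_extension)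
      with * show False by simp
    qed
  qed
  show ?thesis
  proof (rule E.eq_rank_cyclic[where a = a])
    fix x y assume *: "x \<in> insert v X" "y \<in> insert v X" "x \<noteq> a" "y \<noteq> a"
    consider "x = v" "y = v" | "x \<in> X" "y = v" | "x = v" "y \<in> X" | "x \<in> X" "y \<in> X"
      using * by blast
    then show "(a, x, y) \<in> Z' \<longleftrightarrow> insert_rank Z a v (c_between Z' a v) x < insert_rank Z a v (c_between Z' a v) y"
    proof cases
      case 1
      then show ?thesis using E.distinct by blast
    next
      case 2
      then show ?thesis using * old_v assms by (auto simp: insert_rank_def)
    next
      case 3
      then have "(a, v, y) \<in> Z' \<longleftrightarrow> \<not> (a, y, v) \<in> Z'"
        using E.total[of a v y] E.rotate'[of y v a] E.rotate[of a v y] E.asym[of a y v] * 3 assms by blast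
      then show ?thesis using 3 * old_v assms by (auto simp: insert_rank_def)
    next
      case 4
      then show ?thesis
        using * assms mem_extension_iff[OF assms(1)] c_between_less_iff[of a x y]
        by (auto simp: insert_rank_def)
    qed
  qed (use assms(2,3) in \<open>auto simp: insert_rank_def\<close>)
qed

text \<open>Existence: each of the \<open>card X\<close> gaps of the circle is realised by one value
  of \<open>s\<close>.\<close>

lemma rank_cyclic_insert_rank:
  assumes "v \<notin> X" "a \<in> X" "s < card X"
  defines "Z' \<equiv> rank_cyclic (insert v X) (insert_rank Z a v s)"
  shows "Z' \<in> extensions X Z v" and "c_between Z' a v = s"
    and "\<And>b. b \<in> X \<Longrightarrow> b \<noteq> a \<Longrightarrow> (a, v, b) \<in> Z' \<longleftrightarrow> s \<le> c_between Z a b"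
proof -
  have inj: "inj_on (c_between Z a) (X - {a})"
    and img: "c_between Z a ` (X - {a}) = {..<card X - 1}"
    using bij_betw_c_between[OF assms(2)] by (simp_all add: bij_betw_def)
  have "inj_on (insert_rank Z a v s) (insert v X)"
  proof (rule inj_onI)
    fix x y assume *: "x \<in> insert v X" "y \<in> insert v X" "insert_rank Z a v s x = insert_rank Z a v s y"
    \<comment> \<open>Parity separates \<open>v\<close> from the old elements.\<close>
    have "even (insert_rank Z a v s u) \<longleftrightarrow> u \<noteq> v" for u
      by (simp add: insert_rank_def)
    then have "x = v \<longleftrightarrow> y = v"
      using *(3) by metis
    then show "x = y"
      using inj_onD[OF inj, of x y] * by (cases "x = v") (auto simp: insert_rank_def split: if_splits)
  qed
  then have "total_cyclic_order (insert v X) Z'"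
    unfolding Z'_def by (rule total_cyclic_order_rank_cyclic)
  moreover have "rank_cyclic X (insert_rank Z a v s) = Z"
    using assms(1,2) c_between_less_iff[of a]
    by (intro eq_rank_cyclic[where a = a, symmetric]) (auto simp: insert_rank_def)
  moreover have "Z' \<inter> X \<times> X \<times> X = rank_cyclic X (insert_rank Z a v s)"
    unfolding Z'_def by (auto simp: mem_rank_cyclic)
  ultimately show "Z' \<in> extensions X Z v"
    by (simp add: extensions_def)
  show "(a, v, b) \<in> Z' \<longleftrightarrow> s \<le> c_between Z a b" if "b \<in> X" "b \<noteq> a" for b
    using that assms(1,2) by (auto simp: Z'_def mem_rank_cyclic insert_rank_def)
  \<comment> \<open>The even rank \<open>2 * c_between Z a x + 2\<close> is below
    \<open>2 * s + 1\<close> exactly when \<open>c_between Z a x < s\<close>.\<close>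
  have "{x. (a, x, v) \<in> Z'} = {x \<in> X - {a}. c_between Z a x < s}"
    using assms(1,2) by (auto simp: Z'_def mem_rank_cyclic insert_rank_def split: if_splits)
  moreover have "c_between Z a ` {x \<in> X - {a}. c_between Z a x < s} = {..<s}"
  proof -
    have "c_between Z a ` {x \<in> X - {a}. c_between Z a x < s} = c_between Z a ` (X - {a}) \<inter> {..<s}"
      by auto
    \<comment> \<open>As \<open>s < card X\<close>, all positions below \<open>s\<close> are
      occupied.\<close>
    also have "\<dots> = {..<s}"
      unfolding img using assms(3) by auto
    finally show ?thesis .
  qed
  moreover have "inj_on (c_between Z a) {x \<in> X - {a}. c_between Z a x < s}"
    using inj by (rule inj_on_subset) auto
  ultimately show "c_between Z' a v = s"
    unfolding c_between_def[of Z'] by (metis card_image card_lessThan)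
qed

text \<open>An arc with \<open>c\<close> inner elements has \<open>c + 1\<close> gaps, so both
  bounds of the interval are attained.\<close>

lemma bij_betw_extensions_arc:
  assumes "v \<notin> X" "a \<in> X" "b \<in> X" "a \<noteq> b"
  shows "bij_betw (\<lambda>Z'. c_between Z' a v) {Z' \<in> extensions X Z v. (a, v, b) \<in> Z'} {0..c_between Z a b}"
proof (rule bij_betw_byWitness)
  let ?R = "\<lambda>s. rank_cyclic (insert v X) (insert_rank Z a v s)"
  have bound: "c_between Z a b < card X - 1"
    using bij_betw_c_between[OF assms(2)] assms(3,4) unfolding bij_betw_def by blast
  show "\<forall>Z'\<in>{Z' \<in> extensions X Z v. (a, v, b) \<in> Z'}. ?R (c_between Z' a v) = Z'"
    using extension_eq_rank_cyclic[OF _ assms(1,2), symmetric] by blast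
  show "\<forall>s\<in>{0..c_between Z a b}. c_between (?R s) a v = s"
    using rank_cyclic_insert_rank(2)[OF assms(1,2)] bound by simp
  show "?R ` {0..c_between Z a b} \<subseteq> {Z' \<in> extensions X Z v. (a, v, b) \<in> Z'}"
    using rank_cyclic_insert_rank(1,3)[OF assms(1,2)] bound assms(3,4) by auto
  show "(\<lambda>Z'. c_between Z' a v) ` {Z' \<in> extensions X Z v. (a, v, b) \<in> Z'} \<subseteq> {0..c_between Z a b}"
  proof clarsimp
    fix Z' assume *: "Z' \<in> extensions X Z v" "(a, v, b) \<in> Z'"
    interpret E: finite_cyclic_order "insert v X" Z'
      using *(1) by (rule finite_cyclic_order_extension)
    show "c_between Z' a v \<le> c_between Z a b"
      using E.c_between_add[OF *(2)] c_between_extension[OF *(1) assms(1-3)] *(2) by simp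
  qed
qed

lemma sum_extensions_arc:
  assumes "v \<notin> X" "a \<in> X" "b \<in> X" "a \<noteq> b"
    and "\<And>Z'. Z' \<in> extensions X Z v \<Longrightarrow> (a, v, b) \<in> Z' \<Longrightarrow> F Z' = g (c_between Z' a v)"
  shows "(\<Sum>Z' | Z' \<in> extensions X Z v \<and> (a, v, b) \<in> Z'. F Z') = (\<Sum>s=0..c_between Z a b. g s)"
proof -
  have "(\<Sum>Z' | Z' \<in> extensions X Z v \<and> (a, v, b) \<in> Z'. F Z') =
      (\<Sum>Z' | Z' \<in> extensions X Z v \<and> (a, v, b) \<in> Z'. g (c_between Z' a v))"
    using assms(5) by (intro sum.cong) simp_all
  also have "\<dots> = (\<Sum>s=0..c_between Z a b. g s)"
    using bij_betw_extensions_arc[OF assms(1-4)] by (rule sum.reindex_bij_betw)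
  finally show ?thesis .
qed

text \<open>Every arc length needed after \<open>v\<close> enters the arc from \<open>p\<close> to
  \<open>q\<close>. Rotating the hypothesis on \<open>p\<close>, \<open>q\<close>, \<open>r\<close>
  covers the three possible arcs.\<close>

lemma c_between_extension_arc:
  assumes "v \<notin> X" "Z' \<in> extensions X Z v" "(p, q, r) \<in> Z" "(p, v, q) \<in> Z'"
  shows "c_between Z' v q = c_between Z p q - c_between Z' p v"
    and "c_between Z' q r = c_between Z q r"
    and "c_between Z' r p = c_between Z r p"
    and "c_between Z' q p = c_between Z q r + 1 + c_between Z r p"
    and "c_between Z' v r = c_between Z p q - c_between Z' p v + 1 + c_between Z q r"
    and "c_between Z' r v = c_between Z r p + 1 + c_between Z' p v"
proof -
  interpret E: finite_cyclic_order "insert v X" Z'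
    using assms(2) by (rule finite_cyclic_order_extension)
  have X: "p \<in> X" "q \<in> X" "r \<in> X"
    using in_carrier[OF assms(3)] by auto
  have pqr: "(p, q, r) \<in> Z'"
    using mem_extension_iff[OF assms(2) X] assms(3) by blast
  have pvr: "(p, v, r) \<in> Z'"
    by (rule E.trans[OF assms(4) pqr])
  have rpv: "(r, p, v) \<in> Z'"
    by (rule E.rotate'[OF pvr])
  have vqr: "(v, q, r) \<in> Z'"
    by (rule E.rotate'[OF E.trans[OF E.rotate[OF pqr] E.rotate'[OF assms(4)]]])
  \<comment> \<open>Arcs disjoint from the one receiving \<open>v\<close> keep their old
    lengths.\<close>
  have "(q, v, p) \<notin> Z'" "(q, v, r) \<notin> Z'" "(r, v, p) \<notin> Z'"
    using E.asym[OF assms(4)] E.asym[OF E.rotate[OF vqr]] E.asym[OF pvr] E.rotate[of q v r] by blast+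
  then have c: "c_between Z' q p = c_between Z q p" "c_between Z' q r = c_between Z q r"
    "c_between Z' r p = c_between Z r p" "c_between Z' p q = c_between Z p q + 1"
    using assms(4) by (simp_all add: c_between_extension[OF assms(2,1)] X)
  show vq: "c_between Z' v q = c_between Z p q - c_between Z' p v"
    using E.c_between_add[OF assms(4)] c by simp
  show "c_between Z' q r = c_between Z q r" "c_between Z' r p = c_between Z r p"
    using c by simp_all
  show "c_between Z' q p = c_between Z q r + 1 + c_between Z r p"
    using c_between_add[OF rotate[OF assms(3)]] c by simp
  show "c_between Z' v r = c_between Z p q - c_between Z' p v + 1 + c_between Z q r"
    using E.c_between_add[OF vqr] vq c by simp
  show "c_between Z' r v = c_between Z r p + 1 + c_between Z' p v"
    using E.c_between_add[OF rpv] c by simp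
qed

end

section \<open>The recurrence\<close>

definition monomial3 :: "nat \<Rightarrow> nat \<Rightarrow> nat \<Rightarrow> int_mpoly" where
  "monomial3 i j k = Var 1 ^ i * Var 2 ^ j * Var 3 ^ k"

lemma Phi_monomial3:
  assumes "b \<in> {1..3}" "c \<in> {1..3}"
  shows "Phi a b c (monomial3 (e 1) (e 2) (e 3)) =
    (\<Prod>l\<in>{1, 2, 3} - {b, c}. Var l ^ e l) * Var a ^ (e b + 1) * (\<Sum>k=0..e c. Var b ^ (e c - k) * Var c ^ k)"
proof -
  have "{1..3} = {1, 2, 3 :: nat}"
    by auto
  then show ?thesis
    using Phi_prod[OF assms, of a e] by (simp add: monomial3_def mult.assoc)
qed

text \<open>Needed where the index \<open>s\<close> should be carried by the exponent of
  \<open>Var b\<close> instead of \<open>Var c\<close>.\<close>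

lemma sum_powers_flip:
  "(\<Sum>k=0..n. x ^ (n - k) * y ^ k) = (\<Sum>k=0..n. x ^ k * y ^ (n - k))" for x y :: "'a :: comm_semiring_1"
  by (subst sum.atLeastAtMost_rev) (simp add: atLeast0AtMost)

text \<open>The index \<open>s\<close> will be the number of points between the start of the
  admissible arc and the new point. The exponents are written as in
  \<open>c_between_extension_arc\<close>, so that both can be matched syntactically.\<close>

lemma Phi_monomial3_cases:
  "Phi 2 2 1 (monomial3 i j k) = (\<Sum>s=0..i. monomial3 s (i - s + 1 + j) k)"
  "Phi 3 1 2 (monomial3 i j k) = (\<Sum>s=0..j. monomial3 s (j - s) (k + 1 + i))"
  "Phi 1 1 3 (monomial3 i j k) = (\<Sum>s=0..k. monomial3 (k - s + 1 + i) j s)"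
  "Phi 1 1 2 (monomial3 i j k) = (\<Sum>s=0..j. monomial3 (i + 1 + s) (j - s) k)"
  "Phi 3 3 1 (monomial3 i j k) = (\<Sum>s=0..i. monomial3 (i - s) j (k + 1 + s))"
  "Phi 2 1 3 (monomial3 i j k) = (\<Sum>s=0..k. monomial3 (k - s) (i + 1 + j) s)"
proof -
  let ?e = "\<lambda>l. if l = 1 then i else if l = 2 then j else k :: nat"
  note P = Phi_monomial3[where e = ?e, simplified]
  show "Phi 2 2 1 (monomial3 i j k) = (\<Sum>s=0..i. monomial3 s (i - s + 1 + j) k)"
    unfolding monomial3_def power_add power_one_right
    using P[of 2 1 2] by (simp add: insert_Diff_if monomial3_def sum_distrib_left mult_ac)
  show "Phi 3 1 2 (monomial3 i j k) = (\<Sum>s=0..j. monomial3 s (j - s) (k + 1 + i))"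
    unfolding monomial3_def power_add power_one_right
    using P[of 1 2 3, unfolded sum_powers_flip] by (simp add: insert_Diff_if monomial3_def sum_distrib_left mult_ac)
  show "Phi 1 1 3 (monomial3 i j k) = (\<Sum>s=0..k. monomial3 (k - s + 1 + i) j s)"
    unfolding monomial3_def power_add power_one_right
    using P[of 1 3 1] by (simp add: insert_Diff_if monomial3_def sum_distrib_left mult_ac)
  show "Phi 1 1 2 (monomial3 i j k) = (\<Sum>s=0..j. monomial3 (i + 1 + s) (j - s) k)"
    unfolding monomial3_def power_add power_one_right
    using P[of 1 2 1, unfolded sum_powers_flip] by (simp add: insert_Diff_if monomial3_def sum_distrib_left mult_ac)
  show "Phi 3 3 1 (monomial3 i j k) = (\<Sum>s=0..i. monomial3 (i - s) j (k + 1 + s))"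
    unfolding monomial3_def power_add power_one_right
    using P[of 3 1 3, unfolded sum_powers_flip] by (simp add: insert_Diff_if monomial3_def sum_distrib_left mult_ac)
  show "Phi 2 1 3 (monomial3 i j k) = (\<Sum>s=0..k. monomial3 (k - s) (i + 1 + j) s)"
    unfolding monomial3_def power_add power_one_right
    using P[of 1 3 2] by (simp add: insert_Diff_if monomial3_def sum_distrib_left mult_ac)
qed

lemma Phi_sum: "finite A \<Longrightarrow> Phi a b c (\<Sum>x\<in>A. f x) = (\<Sum>x\<in>A. Phi a b c (f x))"
  by (simp add: Phi_def frag_extend_sum)

section \<open>\<open>Q_poly\<close> as a weighted sum over orders\<close>

text \<open>The monomial contributed by a single order whose largest point is \<open>m\<close>;
  summing it over orders avoids the coefficients \<open>f_count\<close>.\<close>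

fun weight :: "sign \<Rightarrow> nat \<Rightarrow> (nat \<times> nat \<times> nat) set \<Rightarrow> int_mpoly" where
  "weight Plus m Z = monomial3 (c_between Z (m - 1) m) (c_between Z m 1) (c_between Z 1 (m - 1))"
| "weight Minus m Z = monomial3 (c_between Z m (m - 1)) (c_between Z (m - 1) 1) (c_between Z 1 m)"

lemma finite_cyclic_order_P_set: "Z \<in> P_set w \<Longrightarrow> finite_cyclic_order {1..length w + 2} Z"
  by unfold_locales (simp_all add: P_set_def)

lemma Q_set_subset: "Q_set \<eta> w \<subseteq> P_set w"
  by (cases \<eta>) (auto simp: Let_def)

lemma finite_P_set: "finite (P_set w)"
proof (rule finite_subset)
  show "P_set w \<subseteq> Pow ({1..length w + 2} \<times> {1..length w + 2} \<times> {1..length w + 2})"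
  proof (intro subsetI PowI)
    fix Z t assume Z: "Z \<in> P_set w" "t \<in> Z"
    obtain x y z where t: "t = (x, y, z)"
      by (cases t)
    interpret finite_cyclic_order "{1..length w + 2}" Z
      using Z(1) by (rule finite_cyclic_order_P_set)
    show "t \<in> {1..length w + 2} \<times> {1..length w + 2} \<times> {1..length w + 2}"
      using in_carrier[of x y z] Z(2) unfolding t by blast
  qed
qed simp

lemma finite_Q_set: "finite (Q_set \<eta> w)"
  using finite_P_set Q_set_subset by (rule finite_subset[rotated])

text \<open>Orders are grouped by their arc lengths; each class contributes its cardinality
  \<open>f_count\<close> times one monomial.\<close>

lemma Q_poly_eq_sum_weight: "Q_poly \<eta> w = (\<Sum>Z\<in>Q_set \<eta> w. weight \<eta> (length w + 2) Z)"
proof -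
  define m where "m = length w + 2"
  define t where "t Z = (case \<eta> of
      Plus \<Rightarrow> (c_between Z (m - 1) m, c_between Z m 1, c_between Z 1 (m - 1))
    | Minus \<Rightarrow> (c_between Z m (m - 1), c_between Z (m - 1) 1, c_between Z 1 m))" for Z
  let ?T = "{(i, j, k). i + j + k = length w - 1}"
  have count: "f_count \<eta> w i j k = card {Z \<in> Q_set \<eta> w. t Z = (i, j, k)}" for i j k
    by (cases \<eta>) (simp_all add: t_def m_def c_tilde_def Let_def)
  have weight: "weight \<eta> m Z = (case t Z of (i, j, k) \<Rightarrow> monomial3 i j k)" for Z
    by (cases \<eta>) (simp_all add: t_def)
  \<comment> \<open>By \<open>sum_c_between\<close> the lengths add up to \<open>m - 3\<close>, that
    is \<open>length w - 1\<close>. For the empty word \<open>Q_set\<close> is empty, as its triple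
    would repeat the point 1, so truncated subtraction does no harm.\<close>
  have range: "t Z \<in> ?T" if "Z \<in> Q_set \<eta> w" for Z
  proof -
    interpret finite_cyclic_order "{1..m}" Z
      unfolding m_def using that Q_set_subset by (intro finite_cyclic_order_P_set) blast
    show ?thesis
    proof (cases \<eta>)
      case Plus
      then have "(m - 1, m, 1) \<in> Z"
        using that by (simp add: m_def Let_def)
      from sum_c_between[OF this] show ?thesis
        using Plus by (simp add: t_def) (simp add: m_def)
    next
      case Minus
      then have "(1, m, m - 1) \<in> Z"
        using that by (simp add: m_def Let_def)
      from sum_c_between[OF rotate[OF this]] show ?thesis
        using Minus by (simp add: t_def) (simp add: m_def)
    qed
  qed
  have "Q_poly \<eta> w = (\<Sum>y\<in>?T. \<Sum>Z | Z \<in> Q_set \<eta> w \<and> t Z = y. weight \<eta> m Z)"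
    unfolding Q_poly_def
  proof (rule sum.cong)
    fix y assume "y \<in> ?T"
    obtain i j k where y: "y = (i, j, k)"
      by (cases y)
    have "(\<Sum>Z | Z \<in> Q_set \<eta> w \<and> t Z = y. weight \<eta> m Z) =
        (\<Sum>Z | Z \<in> Q_set \<eta> w \<and> t Z = y. monomial3 i j k)"
      by (intro sum.cong) (simp_all add: weight y)
    then show "(case y of (i, j, k) \<Rightarrow>
        of_nat (f_count \<eta> w i j k) * Var 1 ^ i * Var 2 ^ j * Var 3 ^ k) =
      (\<Sum>Z | Z \<in> Q_set \<eta> w \<and> t Z = y. weight \<eta> m Z)"
      by (simp add: y count monomial3_def mult.assoc)
  qed simp
  also have "\<dots> = (\<Sum>Z\<in>Q_set \<eta> w. weight \<eta> m Z)"
    by (rule sum.group[OF finite_Q_set finite_sum_triples image_subsetI[OF range]])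
  finally show ?thesis
    by (simp only: m_def)
qed

text \<open>For \<open>Z \<in> P_set w\<close>, these are the conditions on an extension \<open>Z'\<close> of \<open>Z\<close> by the new
  element \<open>m + 1\<close> that come from the last letter \<open>\<sigma>\<close> of \<open>w @ [\<sigma>]\<close> and from the sign \<open>\<eta>\<close>.\<close>

definition snoc_extensions ::
    "sign \<Rightarrow> sign \<Rightarrow> nat \<Rightarrow> (nat \<times> nat \<times> nat) set \<Rightarrow> (nat \<times> nat \<times> nat) set set" where
  "snoc_extensions \<eta> \<sigma> m Z = {Z'. Z' \<in> extensions {1..m} Z (m + 1) \<and>
     (case \<sigma> of Plus \<Rightarrow> (m, m + 1, m - 1) \<in> Z' | Minus \<Rightarrow> (m - 1, m + 1, m) \<in> Z') \<and>
     (case \<eta> of Plus \<Rightarrow> (m, m + 1, 1) \<in> Z' | Minus \<Rightarrow> (1, m + 1, m) \<in> Z')}"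

section \<open>Fibres of the restriction to the first \<open>m\<close> points\<close>

text \<open>The letters of \<open>w\<close> constrain only triples of old points, so
  \<open>Z'\<close> inherits them from \<open>Z\<close>. The last letter and the sign condition
  remain.\<close>

lemma Q_set_snoc_fibre:
  assumes "Z \<in> P_set w"
  defines "m \<equiv> length w + 2"
  shows "{Z' \<in> Q_set \<eta> (w @ [\<sigma>]). Z' \<inter> {1..m} \<times> {1..m} \<times> {1..m} = Z} = snoc_extensions \<eta> \<sigma> m Z"
proof -
  have carrier: "{1..length (w @ [\<sigma>]) + 2} = insert (m + 1) {1..m}"
    by (auto simp: m_def)
  \<comment> \<open>\<open>R\<close> is abstract so that both implications attached to a letter are
    split off together; the last index \<open>length w + 1\<close> is \<open>m - 1\<close>.\<close>
  have letters: "(\<forall>i\<in>{1..length (w @ [\<sigma>])}. R i ((w @ [\<sigma>]) ! (i - 1))) \<longleftrightarrow>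
      (\<forall>i\<in>{1..length w}. R i (w ! (i - 1))) \<and> R (m - 1) \<sigma>" for R
    by (auto simp: m_def nth_append atLeastAtMostSuc_conv)
  have old: "\<forall>i\<in>{1..length w}.
      (w ! (i - 1) = Plus \<longrightarrow> (i, i + 1, i + 2) \<in> Z') \<and> (w ! (i - 1) = Minus \<longrightarrow> (i + 2, i + 1, i) \<in> Z')"
    if "Z' \<inter> {1..m} \<times> {1..m} \<times> {1..m} = Z" for Z'
    using assms(1) that unfolding P_set_def by blast
  have Q: "Z' \<in> Q_set \<eta> (w @ [\<sigma>]) \<longleftrightarrow> Z' \<in> P_set (w @ [\<sigma>]) \<and>
      (case \<eta> of Plus \<Rightarrow> (m, m + 1, 1) \<in> Z' | Minus \<Rightarrow> (1, m + 1, m) \<in> Z')" for Z'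
    by (cases \<eta>) (simp_all add: m_def Let_def)
  have P: "Z' \<in> P_set (w @ [\<sigma>]) \<longleftrightarrow> total_cyclic_order (insert (m + 1) {1..m}) Z' \<and>
      (case \<sigma> of Plus \<Rightarrow> (m, m + 1, m - 1) \<in> Z' | Minus \<Rightarrow> (m - 1, m + 1, m) \<in> Z')"
    if "Z' \<inter> {1..m} \<times> {1..m} \<times> {1..m} = Z" for Z'
  proof -
    \<comment> \<open>Rotation moves the new point into the middle, so that the letter names an arc
      containing it.\<close>
    have "(m - 1, m, m + 1) \<in> Z' \<longleftrightarrow> (m, m + 1, m - 1) \<in> Z'"
      "(m + 1, m, m - 1) \<in> Z' \<longleftrightarrow> (m - 1, m + 1, m) \<in> Z'"
      if "total_cyclic_order (insert (m + 1) {1..m}) Z'"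
    proof -
      interpret E: cyclic_order "insert (m + 1) {1..m}" Z'
        using that by unfold_locales
      show "(m - 1, m, m + 1) \<in> Z' \<longleftrightarrow> (m, m + 1, m - 1) \<in> Z'"
        "(m + 1, m, m - 1) \<in> Z' \<longleftrightarrow> (m - 1, m + 1, m) \<in> Z'"
        using E.rotate E.rotate' by blast+
    qed
    moreover have "m - 1 + 1 = m" "m - 1 + 2 = m + 1"
      by (simp_all add: m_def)
    ultimately show ?thesis
      using old[OF that]
      unfolding P_set_def carrier mem_Collect_eq
        letters[where R = "\<lambda>i \<epsilon>. (\<epsilon> = Plus \<longrightarrow> (i, i + 1, i + 2) \<in> Z') \<and> (\<epsilon> = Minus \<longrightarrow> (i + 2, i + 1, i) \<in> Z')"]
      by (cases \<sigma>) (simp_all only: sign.distinct sign.case simp_thms cong: conj_cong, blast+)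
  qed
  show ?thesis
    unfolding snoc_extensions_def extensions_def using Q P by blast
qed

lemma P_set_restrict:
  assumes "Z' \<in> P_set (w @ [\<sigma>])"
  defines "X \<equiv> {1..length w + 2}"
  shows "Z' \<inter> X \<times> X \<times> X \<in> P_set w"
proof -
  interpret E: cyclic_order "{1..length (w @ [\<sigma>]) + 2}" Z'
    using assms(1) unfolding P_set_def by unfold_locales simp
  have "total_cyclic_order X (Z' \<inter> X \<times> X \<times> X)"
    by (rule E.total_cyclic_order_restrict) (auto simp: X_def)
  moreover have "(w ! (i - 1) = Plus \<longrightarrow> (i, i + 1, i + 2) \<in> Z' \<inter> X \<times> X \<times> X) \<and>
      (w ! (i - 1) = Minus \<longrightarrow> (i + 2, i + 1, i) \<in> Z' \<inter> X \<times> X \<times> X)" if "i \<in> {1..length w}" for i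
  proof -
    have "(w @ [\<sigma>]) ! (i - 1) = w ! (i - 1)" "i \<in> {1..length (w @ [\<sigma>])}"
      using that by (auto simp: nth_append)
    moreover have "i \<in> X" "i + 1 \<in> X" "i + 2 \<in> X"
      using that by (auto simp: X_def)
    ultimately show ?thesis
      using assms(1) unfolding P_set_def by auto
  qed
  ultimately show ?thesis
    unfolding P_set_def X_def by blast
qed

text \<open>A nonempty word makes the last two points and 1 distinct, so totality and asymmetry
  decide their orientation.\<close>

lemma P_set_eq_Un_Q_set:
  assumes "length w \<ge> 1"
  shows "P_set w = Q_set Plus w \<union> Q_set Minus w" "Q_set Plus w \<inter> Q_set Minus w = {}"
proof -
  let ?m = "length w + 2"
  have "(?m - 1, ?m, 1) \<in> Z \<longleftrightarrow> (1, ?m, ?m - 1) \<notin> Z" if "Z \<in> P_set w" for Z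
  proof -
    interpret finite_cyclic_order "{1..?m}" Z
      using that by (rule finite_cyclic_order_P_set)
    show ?thesis
      using total[of "?m - 1" ?m 1] asym[of "?m - 1" ?m 1] assms
      by (auto simp: Suc_le_eq)
  qed
  then show "P_set w = Q_set Plus w \<union> Q_set Minus w" "Q_set Plus w \<inter> Q_set Minus w = {}"
    by (auto simp: Let_def)
qed

text \<open>The orders are grouped by their restriction, and the restrictions by the orientation of
  \<open>m - 1\<close>, \<open>m\<close>, \<open>1\<close>.\<close>

lemma Q_poly_snoc:
  assumes "length w \<ge> 1"
  defines "m \<equiv> length w + 2"
  shows "Q_poly \<eta> (w @ [\<sigma>]) =
    (\<Sum>Z\<in>Q_set Plus w. \<Sum>Z'\<in>snoc_extensions \<eta> \<sigma> m Z. weight \<eta> (m + 1) Z') +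
    (\<Sum>Z\<in>Q_set Minus w. \<Sum>Z'\<in>snoc_extensions \<eta> \<sigma> m Z. weight \<eta> (m + 1) Z')"
proof -
  let ?r = "\<lambda>Z'. Z' \<inter> {1..m} \<times> {1..m} \<times> {1..m}"
  have "Q_poly \<eta> (w @ [\<sigma>]) = (\<Sum>Z'\<in>Q_set \<eta> (w @ [\<sigma>]). weight \<eta> (m + 1) Z')"
    by (simp add: Q_poly_eq_sum_weight m_def)
  also have "\<dots> = (\<Sum>Z\<in>P_set w. \<Sum>Z' | Z' \<in> Q_set \<eta> (w @ [\<sigma>]) \<and> ?r Z' = Z. weight \<eta> (m + 1) Z')"
  proof (rule sum.group[symmetric])
    show "?r ` Q_set \<eta> (w @ [\<sigma>]) \<subseteq> P_set w"
      unfolding m_def using P_set_restrict Q_set_subset by blast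
  qed (rule finite_Q_set finite_P_set)+
  also have "\<dots> = (\<Sum>Z\<in>P_set w. \<Sum>Z'\<in>snoc_extensions \<eta> \<sigma> m Z. weight \<eta> (m + 1) Z')"
    by (intro sum.cong refl) (simp only: Q_set_snoc_fibre[of _ w, folded m_def])
  also have "\<dots> = (\<Sum>Z\<in>Q_set Plus w. \<Sum>Z'\<in>snoc_extensions \<eta> \<sigma> m Z. weight \<eta> (m + 1) Z') +
      (\<Sum>Z\<in>Q_set Minus w. \<Sum>Z'\<in>snoc_extensions \<eta> \<sigma> m Z. weight \<eta> (m + 1) Z')"
    unfolding P_set_eq_Un_Q_set(1)[OF assms(1)]
    by (intro sum.union_disjoint finite_Q_set P_set_eq_Un_Q_set(2)[OF assms(1)])
  finally show ?thesis .
qed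

section \<open>Admissible arcs for the new point\<close>

text \<open>The conditions in \<open>snoc_extensions\<close> may concern arcs passing over the third
  point; such an arc splits at that point into two elementary arcs.\<close>

lemma (in cyclic_order) three_arcs:
  assumes "(p, q, r) \<in> Z" "u \<noteq> p" "u \<noteq> q" "u \<noteq> r"
  shows "(q, u, p) \<in> Z \<longleftrightarrow> (q, u, r) \<in> Z \<or> (r, u, p) \<in> Z"
    and "(r, u, q) \<in> Z \<longleftrightarrow> (r, u, p) \<in> Z \<or> (p, u, q) \<in> Z"
    and "\<not> ((p, u, q) \<in> Z \<and> (q, u, r) \<in> Z)"
  using between_iff[OF rotate[OF assms(1)], of u] between_iff[OF rotate'[OF assms(1)], of u]
    between_disjoint[OF assms(1), of u] assms(2-4)
  by blast+

text \<open>On the cycle \<open>m - 1\<close>, \<open>m\<close>, \<open>1\<close> the letter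
  \<open>Minus\<close> leaves only the arc from \<open>m - 1\<close> to \<open>m\<close>, and
  \<open>Plus\<close> the other two. The sign \<open>Plus\<close> leaves only the arc from
  \<open>m\<close> to \<open>1\<close>, and \<open>Minus\<close> the other two. Intersecting gives
  the four cases.\<close>

lemma snoc_extensions_Q_set_Plus:
  assumes "Z \<in> Q_set Plus w"
  defines "m \<equiv> length w + 2"
  shows "snoc_extensions Plus Plus m Z = {Z' \<in> extensions {1..m} Z (m + 1). (m, m + 1, 1) \<in> Z'}"
    and "snoc_extensions Minus Plus m Z = {Z' \<in> extensions {1..m} Z (m + 1). (1, m + 1, m - 1) \<in> Z'}"
    and "snoc_extensions Plus Minus m Z = {}"
    and "snoc_extensions Minus Minus m Z = {Z' \<in> extensions {1..m} Z (m + 1). (m - 1, m + 1, m) \<in> Z'}"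
proof -
  interpret finite_cyclic_order "{1..m}" Z
    unfolding m_def using assms(1) Q_set_subset by (intro finite_cyclic_order_P_set) blast
  have Z: "(m - 1, m, 1) \<in> Z"
    using assms(1) by (simp add: m_def Let_def)
  have arcs:
    "(m, m + 1, m - 1) \<in> Z' \<longleftrightarrow> (m, m + 1, 1) \<in> Z' \<or> (1, m + 1, m - 1) \<in> Z'"
    "(1, m + 1, m) \<in> Z' \<longleftrightarrow> (1, m + 1, m - 1) \<in> Z' \<or> (m - 1, m + 1, m) \<in> Z'"
    "\<not> ((m - 1, m + 1, m) \<in> Z' \<and> (m, m + 1, 1) \<in> Z')"
    if "Z' \<in> extensions {1..m} Z (m + 1)" for Z'
  proof -
    interpret E: finite_cyclic_order "insert (m + 1) {1..m}" Z'
      using that by (rule finite_cyclic_order_extension)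
    have "(m - 1, m, 1) \<in> Z'"
      using mem_extension_iff[OF that] Z in_carrier[OF Z] by blast
    note E.three_arcs[OF this, of "m + 1"]
    then show
      "(m, m + 1, m - 1) \<in> Z' \<longleftrightarrow> (m, m + 1, 1) \<in> Z' \<or> (1, m + 1, m - 1) \<in> Z'"
      "(1, m + 1, m) \<in> Z' \<longleftrightarrow> (1, m + 1, m - 1) \<in> Z' \<or> (m - 1, m + 1, m) \<in> Z'"
      "\<not> ((m - 1, m + 1, m) \<in> Z' \<and> (m, m + 1, 1) \<in> Z')"
      by (simp_all add: m_def)
  qed
  show "snoc_extensions Plus Plus m Z = {Z' \<in> extensions {1..m} Z (m + 1). (m, m + 1, 1) \<in> Z'}"
    "snoc_extensions Minus Plus m Z = {Z' \<in> extensions {1..m} Z (m + 1). (1, m + 1, m - 1) \<in> Z'}"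
    "snoc_extensions Plus Minus m Z = {}"
    "snoc_extensions Minus Minus m Z = {Z' \<in> extensions {1..m} Z (m + 1). (m - 1, m + 1, m) \<in> Z'}"
    unfolding snoc_extensions_def sign.case using arcs by blast+
qed

text \<open>On the cycle \<open>1\<close>, \<open>m\<close>, \<open>m - 1\<close> the letter
  \<open>Plus\<close> leaves only the arc from \<open>m\<close> to \<open>m - 1\<close>, and the
  sign \<open>Minus\<close> only that from \<open>1\<close> to \<open>m\<close>; the opposite letter
  and sign leave the other two arcs.\<close>

lemma snoc_extensions_Q_set_Minus:
  assumes "Z \<in> Q_set Minus w"
  defines "m \<equiv> length w + 2"
  shows "snoc_extensions Plus Plus m Z = {Z' \<in> extensions {1..m} Z (m + 1). (m, m + 1, m - 1) \<in> Z'}"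
    and "snoc_extensions Minus Plus m Z = {}"
    and "snoc_extensions Plus Minus m Z = {Z' \<in> extensions {1..m} Z (m + 1). (m - 1, m + 1, 1) \<in> Z'}"
    and "snoc_extensions Minus Minus m Z = {Z' \<in> extensions {1..m} Z (m + 1). (1, m + 1, m) \<in> Z'}"
proof -
  interpret finite_cyclic_order "{1..m}" Z
    unfolding m_def using assms(1) Q_set_subset by (intro finite_cyclic_order_P_set) blast
  have Z: "(1, m, m - 1) \<in> Z"
    using assms(1) by (simp add: m_def Let_def)
  have arcs:
    "(m, m + 1, 1) \<in> Z' \<longleftrightarrow> (m, m + 1, m - 1) \<in> Z' \<or> (m - 1, m + 1, 1) \<in> Z'"
    "(m - 1, m + 1, m) \<in> Z' \<longleftrightarrow> (m - 1, m + 1, 1) \<in> Z' \<or> (1, m + 1, m) \<in> Z'"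
    "\<not> ((1, m + 1, m) \<in> Z' \<and> (m, m + 1, m - 1) \<in> Z')"
    if "Z' \<in> extensions {1..m} Z (m + 1)" for Z'
  proof -
    interpret E: finite_cyclic_order "insert (m + 1) {1..m}" Z'
      using that by (rule finite_cyclic_order_extension)
    have "(1, m, m - 1) \<in> Z'"
      using mem_extension_iff[OF that] Z in_carrier[OF Z] by blast
    note E.three_arcs[OF this, of "m + 1"]
    then show
      "(m, m + 1, 1) \<in> Z' \<longleftrightarrow> (m, m + 1, m - 1) \<in> Z' \<or> (m - 1, m + 1, 1) \<in> Z'"
      "(m - 1, m + 1, m) \<in> Z' \<longleftrightarrow> (m - 1, m + 1, 1) \<in> Z' \<or> (1, m + 1, m) \<in> Z'"
      "\<not> ((1, m + 1, m) \<in> Z' \<and> (m, m + 1, m - 1) \<in> Z')"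
      by (simp_all add: m_def)
  qed
  show "snoc_extensions Plus Plus m Z = {Z' \<in> extensions {1..m} Z (m + 1). (m, m + 1, m - 1) \<in> Z'}"
    "snoc_extensions Minus Plus m Z = {}"
    "snoc_extensions Plus Minus m Z = {Z' \<in> extensions {1..m} Z (m + 1). (m - 1, m + 1, 1) \<in> Z'}"
    "snoc_extensions Minus Minus m Z = {Z' \<in> extensions {1..m} Z (m + 1). (1, m + 1, m) \<in> Z'}"
    unfolding snoc_extensions_def sign.case using arcs by blast+
qed

text \<open>The weight of an extension depends only on the old lengths and the position in the
  admissible arc, so the sum is one of those in \<open>Phi_monomial3_cases\<close>.\<close>

lemma sum_weight_snoc_extensions_Plus:
  assumes "Z \<in> Q_set Plus w"
  defines "m \<equiv> length w + 2"
  shows "(\<Sum>Z'\<in>snoc_extensions Plus Plus m Z. weight Plus (m + 1) Z') = Phi 3 1 2 (weight Plus m Z)"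
    and "(\<Sum>Z'\<in>snoc_extensions Minus Plus m Z. weight Minus (m + 1) Z') = Phi 1 1 3 (weight Plus m Z)"
    and "(\<Sum>Z'\<in>snoc_extensions Plus Minus m Z. weight Plus (m + 1) Z') = 0"
    and "(\<Sum>Z'\<in>snoc_extensions Minus Minus m Z. weight Minus (m + 1) Z') = Phi 3 3 1 (weight Plus m Z)"
proof -
  interpret finite_cyclic_order "{1..m}" Z
    unfolding m_def using assms(1) Q_set_subset by (intro finite_cyclic_order_P_set) blast
  have Z: "(m - 1, m, 1) \<in> Z"
    using assms(1) by (simp add: m_def Let_def)
  note ext = snoc_extensions_Q_set_Plus[OF assms(1), folded m_def]
  have new: "m + 1 \<notin> {1..m}"
    by simp
  have X: "m - 1 \<in> {1..m}" "m \<in> {1..m}" "1 \<in> {1..m}" "m - 1 \<noteq> m" "m \<noteq> 1" "1 \<noteq> m - 1"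
    using in_carrier[OF Z] distinct[OF Z] by auto
  show "(\<Sum>Z'\<in>snoc_extensions Plus Plus m Z. weight Plus (m + 1) Z') = Phi 3 1 2 (weight Plus m Z)"
    unfolding ext weight.simps Phi_monomial3_cases
    \<comment> \<open>The rotated triple puts the arc from \<open>m\<close> to \<open>1\<close> in
      the role of \<open>p\<close> to \<open>q\<close>; \<open>add_diff_cancel_right'\<close> turns
      \<open>m + 1 - 1\<close> in the weight into \<open>m\<close>.\<close>
    by (intro sum_extensions_arc new X)
      (simp only: add_diff_cancel_right' c_between_extension_arc[OF new _ rotate[OF Z]])
  show "(\<Sum>Z'\<in>snoc_extensions Minus Plus m Z. weight Minus (m + 1) Z') = Phi 1 1 3 (weight Plus m Z)"
    unfolding ext weight.simps Phi_monomial3_cases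
    by (intro sum_extensions_arc new X)
      (simp only: add_diff_cancel_right' c_between_extension_arc[OF new _ rotate'[OF Z]])
  show "(\<Sum>Z'\<in>snoc_extensions Plus Minus m Z. weight Plus (m + 1) Z') = 0"
    unfolding ext by simp
  show "(\<Sum>Z'\<in>snoc_extensions Minus Minus m Z. weight Minus (m + 1) Z') = Phi 3 3 1 (weight Plus m Z)"
    unfolding ext weight.simps Phi_monomial3_cases
    by (intro sum_extensions_arc new X)
      (simp only: add_diff_cancel_right' c_between_extension_arc[OF new _ Z])
qed

text \<open>The same matching on the reversed cycle, where the opposite pair of letter and sign
  admits no extension.\<close>

lemma sum_weight_snoc_extensions_Minus:
  assumes "Z \<in> Q_set Minus w"
  defines "m \<equiv> length w + 2"
  shows "(\<Sum>Z'\<in>snoc_extensions Plus Plus m Z. weight Plus (m + 1) Z') = Phi 2 2 1 (weight Minus m Z)"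
    and "(\<Sum>Z'\<in>snoc_extensions Minus Plus m Z. weight Minus (m + 1) Z') = 0"
    and "(\<Sum>Z'\<in>snoc_extensions Plus Minus m Z. weight Plus (m + 1) Z') = Phi 1 1 2 (weight Minus m Z)"
    and "(\<Sum>Z'\<in>snoc_extensions Minus Minus m Z. weight Minus (m + 1) Z') = Phi 2 1 3 (weight Minus m Z)"
proof -
  interpret finite_cyclic_order "{1..m}" Z
    unfolding m_def using assms(1) Q_set_subset by (intro finite_cyclic_order_P_set) blast
  have Z: "(1, m, m - 1) \<in> Z"
    using assms(1) by (simp add: m_def Let_def)
  note ext = snoc_extensions_Q_set_Minus[OF assms(1), folded m_def]
  have new: "m + 1 \<notin> {1..m}"
    by simp
  have X: "m - 1 \<in> {1..m}" "m \<in> {1..m}" "1 \<in> {1..m}" "m \<noteq> m - 1" "m - 1 \<noteq> 1" "1 \<noteq> m"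
    using in_carrier[OF Z] distinct[OF Z] by auto
  show "(\<Sum>Z'\<in>snoc_extensions Plus Plus m Z. weight Plus (m + 1) Z') = Phi 2 2 1 (weight Minus m Z)"
    unfolding ext weight.simps Phi_monomial3_cases
    by (intro sum_extensions_arc new X)
      (simp only: add_diff_cancel_right' c_between_extension_arc[OF new _ rotate[OF Z]])
  show "(\<Sum>Z'\<in>snoc_extensions Minus Plus m Z. weight Minus (m + 1) Z') = 0"
    unfolding ext by simp
  show "(\<Sum>Z'\<in>snoc_extensions Plus Minus m Z. weight Plus (m + 1) Z') = Phi 1 1 2 (weight Minus m Z)"
    unfolding ext weight.simps Phi_monomial3_cases
    by (intro sum_extensions_arc new X)
      (simp only: add_diff_cancel_right' c_between_extension_arc[OF new _ rotate'[OF Z]])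
  show "(\<Sum>Z'\<in>snoc_extensions Minus Minus m Z. weight Minus (m + 1) Z') = Phi 2 1 3 (weight Minus m Z)"
    unfolding ext weight.simps Phi_monomial3_cases
    by (intro sum_extensions_arc new X)
      (simp only: add_diff_cancel_right' c_between_extension_arc[OF new _ Z])
qed

theorem theorem3:
  fixes n :: nat and w :: "sign list"
  assumes "n \<ge> 1" and "length w = n"
  shows "Q_poly Plus (w @ [Plus]) = Phi 2 2 1 (Q_poly Minus w) + Phi 3 1 2 (Q_poly Plus w) \<and>
    Q_poly Minus (w @ [Plus]) = Phi 1 1 3 (Q_poly Plus w) \<and>
    Q_poly Plus (w @ [Minus]) = Phi 1 1 2 (Q_poly Minus w) \<and>
    Q_poly Minus (w @ [Minus]) = Phi 3 3 1 (Q_poly Plus w) + Phi 2 1 3 (Q_poly Minus w)"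
proof -
  have "length w \<ge> 1"
    using assms by simp
  note snoc = Q_poly_snoc[OF this]
  show ?thesis
    \<comment> \<open>The longer words are split first; \<open>Q_poly_eq_sum_weight\<close> would
      rewrite their polynomials as well.\<close>
    unfolding snoc
    unfolding Q_poly_eq_sum_weight Phi_sum[OF finite_Q_set]
    \<comment> \<open>The vanishing sums leave one term in the second and third identities. Only the
      first lists its terms in the other order, hence the final commutation.\<close>
    by (simp only: sum_weight_snoc_extensions_Plus sum_weight_snoc_extensions_Minus sum.neutral_const
        add_0_left add_0_right simp_thms cong: sum.cong) (rule add.commute)
qed

end
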